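(* Let $(p^*,E)$ be a bar framework in $\mathbb{R}^d$ with $n$ vertices and edges $E_1,\dots,E_m$. Suppose $(p^*,E)$ is prestress stable, and let $\omega\in\mathbb{R}^m$ be a self-stress that guarantees prestress stability. For each $k$ consider the problems $P_k^{\pm}$ with lengths $l_i=|p^*_{i,1}-p^*_{i,2}|$, $i\ne k$. Then, for each edge $E_k$ such that $\omega_k>0$, $p^*$ is a strict local solution up to rigid body motions for $P_k^+$, and for each edge $E_k$ such that $\omega_k<0$, $p^*$ is a strict local solution up to rigid body motions for $P_k^-$.
   Context: A bar framework $(p,E)$ in $\mathbb{R}^d$ consists of vertex positions $p=(p_1,\dots,p_n)\in\mathbb{R}^{nd}$, $p_i\in\mathbb{R}^d$, and edges $E=\{E_1,\dots,E_m\}$, each joining two distinct vertices; the endpoints of $E_i$ are denoted $p_{i,1},p_{i,2}$. Set $f_i(p)=|p_{i,1}-p_{i,2}|^2$. The rigidity matrix $R(p)\in\mathbb{R}^{m\times nd}$ has $i$th row $\nabla f_i(p)$ (and $R(v)$ denotes the same matrix evaluated at $v\in\mathbb{R}^{nd}$). Two configurations are congruent if they differ by an isometry of $\mathbb{R}^d$ applied to all vertices. The space of trivial flexes is $\mathcal{T}(p)=\{v\in\mathbb{R}^{nd}: v_i=Ap_i+b,\ A\in\mathbb{R}^{d\times d}\text{ skew-symmetric},\ b\in\mathbb{R}^d\}$. A self-stress is a vector $\omega\in\mathbb{R}^m$ with $R(p)^T\omega=0$. The framework $(p,E)$ is prestress stable if there exists a self-stress $\omega$ such that $\omega^TR(v)v>0$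 for all nonzero $v\in\mathrm{null}\,R(p)\cap\mathcal{T}(p)^\perp$; such an $\omega$ is said to guarantee prestress stability. Problem $P_k^{\pm}$ is: $\min_{p\in\mathbb{R}^{nd}} \pm f_k(p)$ subject to $f_i(p)=l_i^2$ for $i=1,\dots,m$, $i\ne k$ ($P_k^+$ minimizes $f_k$, $P_k^-$ maximizes $f_k$). A point is feasible if it satisfies the constraints. A point $p^*$ is a strict local solution of $P_k^+$ (resp. $P_k^-$) up to rigid body motions if it is feasible and there is a neighborhood $U$ of $p^*$ such that every feasible $q\in U$ not congruent to $p^*$ has $f_k(q)>f_k(p^* )$ (resp. $f_k(q)<f_k(p^* )$). *)

theory Defs
  imports "HOL-Analysis.Analysis"
begin

text \<open>
  The dimension is \<open>d = CARD('d)\<close>, the number of vertices \<open>n = CARD('n)\<close>, the number of edges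
  \<open>m = CARD('m)\<close>. A configuration in \<open>R^{nd}\<close> is a vector with coordinates indexed by pairs
  (vertex, spatial coordinate), so that the rigidity matrix is an ordinary \<open>m \<times> nd\<close> matrix.
\<close>

type_synonym ('d, 'n) config = "real ^ ('n \<times> 'd)"

definition pos :: "('d::finite, 'n::finite) config \<Rightarrow> 'n \<Rightarrow> real ^ 'd" where
  "pos p i = (\<chi> a. p $ (i, a))"

text \<open>
  Edges are enumerated by \<open>'m\<close>. The orientation in \<open>'n \<times> 'n\<close> only records the (arbitrary) naming
  of the two endpoints; distinctness of edges is that of the underlying unordered pairs.
\<close>

definition bar_edges :: "('m \<Rightarrow> 'n \<times> 'n) \<Rightarrow> bool" where
  "bar_edges E \<longleftrightarrow> (\<forall>i. fst (E i) \<noteq> snd (E i)) \<and> inj (\<lambda>i. {fst (E i), snd (E i)})"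

definition edge_length :: "('m \<Rightarrow> 'n::finite \<times> 'n) \<Rightarrow> ('d::finite, 'n) config \<Rightarrow> 'm \<Rightarrow> real" where
  "edge_length E p i = norm (pos p (fst (E i)) - pos p (snd (E i)))"

definition edge_fun :: "('m \<Rightarrow> 'n::finite \<times> 'n) \<Rightarrow> 'm \<Rightarrow> ('d::finite, 'n) config \<Rightarrow> real" where
  "edge_fun E i p = (norm (pos p (fst (E i)) - pos p (snd (E i))))\<^sup>2"

definition gradient :: "('a::real_inner \<Rightarrow> real) \<Rightarrow> 'a \<Rightarrow> 'a" where
  "gradient f x = (THE D. GDERIV f x :> D)"

definition rigidity_matrix ::
    "('m::finite \<Rightarrow> 'n::finite \<times> 'n) \<Rightarrow> ('d::finite, 'n) config \<Rightarrow> real ^ ('n \<times> 'd) ^ 'm" where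
  "rigidity_matrix E p = (\<chi> i. gradient (edge_fun E i) p)"

definition null_space :: "real ^ 'a ^ 'b \<Rightarrow> (real ^ 'a) set" where
  "null_space A = {v. A *v v = 0}"

definition congruent_configs ::
    "('d::finite, 'n::finite) config \<Rightarrow> ('d, 'n) config \<Rightarrow> bool" where
  "congruent_configs p q \<longleftrightarrow>
     (\<exists>T :: real ^ 'd \<Rightarrow> real ^ 'd. (\<forall>x y. dist (T x) (T y) = dist x y) \<and>
        (\<forall>i. pos q i = T (pos p i)))"

definition trivial_flexes :: "('d::finite, 'n::finite) config \<Rightarrow> ('d, 'n) config set" where
  "trivial_flexes p =
     {v. \<exists>(A :: real ^ 'd ^ 'd) b. transpose A = - A \<and> (\<forall>i. pos v i = A *v pos p i + b)}"

definition self_stress ::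
    "('m::finite \<Rightarrow> 'n::finite \<times> 'n) \<Rightarrow> ('d::finite, 'n) config \<Rightarrow> real ^ 'm \<Rightarrow> bool" where
  "self_stress E p \<omega> \<longleftrightarrow> transpose (rigidity_matrix E p) *v \<omega> = 0"

definition guarantees_prestress_stability ::
    "('m::finite \<Rightarrow> 'n::finite \<times> 'n) \<Rightarrow> ('d::finite, 'n) config \<Rightarrow> real ^ 'm \<Rightarrow> bool" where
  "guarantees_prestress_stability E p \<omega> \<longleftrightarrow>
     self_stress E p \<omega> \<and>
     (\<forall>v \<in> null_space (rigidity_matrix E p) \<inter> orthogonal_comp (trivial_flexes p).
        v \<noteq> 0 \<longrightarrow> \<omega> \<bullet> (rigidity_matrix E v *v v) > 0)"

definition prestress_stable ::
    "('m::finite \<Rightarrow> 'n::finite \<times> 'n) \<Rightarrow> ('d::finite, 'n) config \<Rightarrow> bool" where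
  "prestress_stable E p \<longleftrightarrow> (\<exists>\<omega>. guarantees_prestress_stability E p \<omega>)"

text \<open>
  The problems \<open>P\<^sub>k\<^sup>\<plusminus>\<close> with prescribed lengths \<open>l\<close>; the value \<open>l k\<close> is irrelevant.
\<close>

definition feasible ::
    "('m \<Rightarrow> 'n::finite \<times> 'n) \<Rightarrow> 'm \<Rightarrow> ('m \<Rightarrow> real) \<Rightarrow> ('d::finite, 'n) config \<Rightarrow> bool" where
  "feasible E k l p \<longleftrightarrow> (\<forall>i. i \<noteq> k \<longrightarrow> edge_fun E i p = (l i)\<^sup>2)"

definition strict_local_solution_plus ::
    "('m \<Rightarrow> 'n::finite \<times> 'n) \<Rightarrow> 'm \<Rightarrow> ('m \<Rightarrow> real) \<Rightarrow> ('d::finite, 'n) config \<Rightarrow> bool" where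
  "strict_local_solution_plus E k l p \<longleftrightarrow>
     feasible E k l p \<and>
     (\<exists>U. open U \<and> p \<in> U \<and>
        (\<forall>q\<in>U. feasible E k l q \<and> \<not> congruent_configs p q \<longrightarrow> edge_fun E k q > edge_fun E k p))"

definition strict_local_solution_minus ::
    "('m \<Rightarrow> 'n::finite \<times> 'n) \<Rightarrow> 'm \<Rightarrow> ('m \<Rightarrow> real) \<Rightarrow> ('d::finite, 'n) config \<Rightarrow> bool" where
  "strict_local_solution_minus E k l p \<longleftrightarrow>
     feasible E k l p \<and>
     (\<exists>U. open U \<and> p \<in> U \<and>
        (\<forall>q\<in>U. feasible E k l q \<and> \<not> congruent_configs p q \<longrightarrow> edge_fun E k q < edge_fun E k p))"

text \<open>
  \<open>gradient\<close> is total; the following shows that it is meaningful for the edge functions.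
\<close>

lemma gradient_eqI:
  assumes "GDERIV f x :> D"
  shows "gradient f x = D"
proof -
  have "D' = D" if "GDERIV f x :> D'" for D'
  proof -
    have "(\<lambda>h. h \<bullet> D') = (\<lambda>h. h \<bullet> D)"
      using has_derivative_unique[OF that[unfolded gderiv_def] assms[unfolded gderiv_def]] .
    then have "x \<bullet> D' = x \<bullet> D" for x by (rule fun_cong)
    then show ?thesis using vector_eq_ldot by blast
  qed
  with assms show ?thesis unfolding gradient_def by blast
qed

lemma GDERIV_edge_fun: "GDERIV (edge_fun E i) p :> gradient (edge_fun E i) p"
proof -
  have lin: "bounded_linear (\<lambda>q. pos q (fst (E i)) - pos q (snd (E i)))"
    by (rule linear_conv_bounded_linear[THEN iffD1], rule linearI)
      (auto simp: pos_def vec_eq_iff algebra_simps)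
  let ?g = "\<lambda>q. pos q (fst (E i)) - pos q (snd (E i))"
  let ?D = "\<lambda>h. 2 * (?g p \<bullet> ?g h)"
  have der: "(edge_fun E i has_derivative ?D) (at p)"
    unfolding edge_fun_def power2_norm_eq_inner
    by (rule has_derivative_eq_rhs[OF has_derivative_inner
          [OF bounded_linear_imp_has_derivative[OF lin] bounded_linear_imp_has_derivative[OF lin]]])
      (simp add: inner_commute)
  define D where "D = ?D"
  have derD: "(edge_fun E i has_derivative D) (at p)"
    using der by (simp only: D_def)
  have "D h = h \<bullet> adjoint D 1" for h
    using adjoint_works[OF has_derivative_linear[OF derD], of h 1] by simp
  then have "(\<lambda>h. h \<bullet> adjoint D 1) = D"
    by (intro ext) (rule sym)
  then have "GDERIV (edge_fun E i) p :> adjoint D 1"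
    unfolding gderiv_def using derD by (simp only:)
  then show ?thesis using gradient_eqI[of "edge_fun E i" p "adjoint D 1"] by simp
qed

end

theory Submission
  imports Defs
begin

text \<open>
  Write \<open>f\<^sub>i\<close> for the squared length of edge \<open>i\<close>. It is a quadratic form, so
  \<open>f\<^sub>i (p + v) = f\<^sub>i p + R\<^sub>i(p) v + f\<^sub>i v\<close> exactly. Weighting by a self-stress \<open>\<omega>\<close> kills
  the linear terms: the weighted sum of all length changes from \<open>p\<close> to \<open>p + v\<close> is the
  stress energy \<open>S v = \<Sum>i. \<omega>\<^sub>i f\<^sub>i v\<close>, half of \<open>\<omega>\<^sup>T R(v) v\<close>. If only edge \<open>k\<close> changes its
  length, the sum is \<open>\<omega>\<^sub>k (f\<^sub>k (p + v) - f\<^sub>k p)\<close>. Both halves of the theorem therefore say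
  that \<open>S (q - p) > 0\<close> for feasible \<open>q\<close> near \<open>p\<close> and not congruent to it.

  Edge lengths do not change under congruence, so \<open>q\<close> may be replaced by the configuration
  congruent to it that is closest to \<open>p\<close>. It is at least as near, it differs from \<open>p\<close>, and
  its displacement \<open>v\<close> from \<open>p\<close> is orthogonal to the trivial flexes
  (\<open>closest_congruent_orthogonal\<close>).

  For such \<open>v\<close>, prestress stability gives \<open>S v > 0\<close> when \<open>v\<close> is a first-order flex. A
  feasible displacement is only nearly one: \<open>R\<^sub>i(p) v = - f\<^sub>i v\<close> for \<open>i \<noteq> k\<close>, which is of second
  order. On unit vectors with \<open>S \<le> 0\<close> orthogonal to the trivial flexes, compactness keeps
  the terms \<open>R\<^sub>i(p) v\<close> with \<open>i \<noteq> k\<close> jointly away from zero. Leaving out row \<open>k\<close> is harmless,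
  since by \<open>\<omega>\<^sub>k \<noteq> 0\<close> the stress makes it a combination of the other rows. By
  scaling, a small feasible \<open>v\<close> cannot have \<open>S v \<le> 0\<close> (\<open>stress_energy_pos_near\<close>).
\<close>

section \<open>Configurations and edge lengths\<close>

lemma pos_add: "pos (p + q) i = pos p i + pos q i"
  and pos_diff: "pos (p - q) i = pos p i - pos q i"
  and pos_scaleR: "pos (c *\<^sub>R p) i = c *\<^sub>R pos p i"
  by (simp_all add: pos_def vec_eq_iff)

lemma continuous_on_pos [continuous_intros]:
  "continuous_on S f \<Longrightarrow> continuous_on S (\<lambda>x. pos (f x) i)"
  unfolding pos_def by (intro continuous_intros)

lemma inner_config: "p \<bullet> q = (\<Sum>i\<in>UNIV. pos p i \<bullet> pos q i)"
proof -
  have "p \<bullet> q = (\<Sum>x\<in>UNIV \<times> UNIV. p $ x * q $ x)"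
    by (simp add: inner_vec_def)
  also have "\<dots> = (\<Sum>i\<in>UNIV. \<Sum>a\<in>UNIV. p $ (i, a) * q $ (i, a))"
    by (simp only: sum.cartesian_product) (simp add: case_prod_unfold)
  finally show ?thesis
    by (simp add: inner_vec_def pos_def)
qed

definition config_of :: "('n \<Rightarrow> real ^ 'd) \<Rightarrow> ('d::finite, 'n::finite) config" where
  "config_of x = (\<chi> ia. x (fst ia) $ snd ia)"

lemma pos_config_of [simp]: "pos (config_of x) i = x i"
  by (simp add: pos_def config_of_def vec_eq_iff)

lemma norm_pos_le: "norm (pos p i) \<le> norm p"
proof -
  have "pos p i \<bullet> pos p i \<le> (\<Sum>i\<in>UNIV. pos p i \<bullet> pos p i)"
    by (rule member_le_sum) auto
  then show ?thesis
    unfolding inner_config[symmetric] by (simp add: norm_le)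
qed

lemma edge_fun_le: "edge_fun E i v \<le> 4 * (norm v)\<^sup>2"
proof -
  have "norm (pos v (fst (E i)) - pos v (snd (E i))) \<le> 2 * norm v"
    using norm_triangle_ineq4[of "pos v (fst (E i))" "pos v (snd (E i))"]
      norm_pos_le[of v "fst (E i)"] norm_pos_le[of v "snd (E i)"] by linarith
  then have "(norm (pos v (fst (E i)) - pos v (snd (E i))))\<^sup>2 \<le> (2 * norm v)\<^sup>2"
    by (intro power_mono) auto
  then show ?thesis by (simp add: edge_fun_def power_mult_distrib)
qed

lemma edge_fun_nonneg: "0 \<le> edge_fun E i v"
  by (simp add: edge_fun_def)

lemma edge_fun_scaleR: "edge_fun E i (c *\<^sub>R v) = c\<^sup>2 * edge_fun E i v"
  by (simp add: edge_fun_def pos_scaleR power_mult_distrib flip: scaleR_diff_right)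

lemma rigidity_matrix_mult:
  "(rigidity_matrix E p *v v) $ i =
    2 * ((pos p (fst (E i)) - pos p (snd (E i))) \<bullet> (pos v (fst (E i)) - pos v (snd (E i))))"
proof -
  let ?g = "\<lambda>q. pos q (fst (E i)) - pos q (snd (E i))"
  have lin: "bounded_linear ?g"
    by (rule linear_conv_bounded_linear[THEN iffD1], rule linearI)
      (auto simp: pos_add pos_scaleR algebra_simps)
  have "(edge_fun E i has_derivative (\<lambda>h. 2 * (?g p \<bullet> ?g h))) (at p)"
    unfolding edge_fun_def power2_norm_eq_inner
    by (rule has_derivative_eq_rhs[OF has_derivative_inner
          [OF bounded_linear_imp_has_derivative[OF lin] bounded_linear_imp_has_derivative[OF lin]]])
      (simp add: inner_commute)
  with GDERIV_edge_fun[of E i p, unfolded gderiv_def]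
  have "(\<lambda>h. h \<bullet> gradient (edge_fun E i) p) = (\<lambda>h. 2 * (?g p \<bullet> ?g h))"
    by (rule has_derivative_unique)
  from fun_cong[OF this, of v] show ?thesis
    by (simp add: matrix_vector_mul_component rigidity_matrix_def inner_commute)
qed

text \<open>
  Exact, with no remainder, because the squared edge length is a quadratic form.
\<close>

lemma edge_fun_add:
  "edge_fun E i (p + v) = edge_fun E i p + (rigidity_matrix E p *v v) $ i + edge_fun E i v"
  by (simp add: rigidity_matrix_mult edge_fun_def pos_add power2_norm_eq_inner
      inner_commute algebra_simps)

lemma rigidity_matrix_self: "(rigidity_matrix E v *v v) $ i = 2 * edge_fun E i v"
  by (simp add: rigidity_matrix_mult edge_fun_def power2_norm_eq_inner)

section \<open>Stress energy\<close>

definition stress_energy ::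
    "('m::finite \<Rightarrow> 'n::finite \<times> 'n) \<Rightarrow> real ^ 'm \<Rightarrow> ('d::finite, 'n) config \<Rightarrow> real" where
  "stress_energy E \<omega> v = (\<Sum>i\<in>UNIV. \<omega> $ i * edge_fun E i v)"

lemma stress_energy_scaleR: "stress_energy E \<omega> (c *\<^sub>R v) = c\<^sup>2 * stress_energy E \<omega> v"
  by (simp add: stress_energy_def edge_fun_scaleR sum_distrib_left mult_ac)

lemma inner_rigidity_matrix_self:
  "\<omega> \<bullet> (rigidity_matrix E v *v v) = 2 * stress_energy E \<omega> v"
  by (simp add: inner_vec_def rigidity_matrix_self stress_energy_def sum_distrib_left mult_ac)

lemma self_stress_inner:
  assumes "self_stress E p \<omega>"
  shows "(\<Sum>i\<in>UNIV. \<omega> $ i * (rigidity_matrix E p *v v) $ i) = 0"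
proof -
  have "\<omega> \<bullet> (rigidity_matrix E p *v v) = (transpose (rigidity_matrix E p) *v \<omega>) \<bullet> v"
    by (simp add: dot_lmul_matrix)
  also have "\<dots> = 0" using assms by (simp add: self_stress_def)
  finally show ?thesis by (simp add: inner_vec_def)
qed

text \<open>
  The first-order terms of the expansion cancel in equilibrium, so the total weighted change
  of squared lengths is a quadratic form in the displacement.
\<close>

lemma self_stress_energy_diff:
  assumes "self_stress E p \<omega>"
  shows "(\<Sum>i\<in>UNIV. \<omega> $ i * (edge_fun E i (p + v) - edge_fun E i p)) = stress_energy E \<omega> v"
  using self_stress_inner[OF assms, of v]
  by (simp add: edge_fun_add stress_energy_def distrib_left sum.distrib)

section \<open>Congruence classes\<close>

lemma compact_orthogonal_matrices: "compact {U :: real ^ 'd ^ 'd. orthogonal_matrix U}"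
proof -
  have "norm U \<le> real CARD('d)" if "orthogonal_matrix U" for U :: "real ^ 'd ^ 'd"
  proof -
    have "norm U \<le> (\<Sum>a\<in>UNIV. norm (U $ a))"
      unfolding norm_vec_def by (rule L2_set_le_sum) simp
    also have "\<dots> = (\<Sum>a\<in>(UNIV::'d set). 1)"
      using that unfolding orthogonal_matrix_orthonormal_rows
      by (intro sum.cong) (auto simp: row_def)
    finally show ?thesis by simp
  qed
  then have "bounded {U :: real ^ 'd ^ 'd. orthogonal_matrix U}"
    by (auto intro: boundedI)
  moreover have "closed {U :: real ^ 'd ^ 'd. orthogonal_matrix U}"
    unfolding orthogonal_matrix matrix_matrix_mult_def transpose_def
    by (intro closed_Collect_eq continuous_intros)
  ultimately show ?thesis by (simp add: compact_eq_bounded_closed)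
qed

text \<open>
  Stating congruence through an orthogonal matrix and differences of positions eliminates the
  unbounded translation, so that compactness of the orthogonal group suffices for closedness.
\<close>

definition congruence_class ::
    "('d::finite, 'n::finite) config \<Rightarrow> ('d, 'n) config set" where
  "congruence_class q = {q'. \<exists>U. orthogonal_matrix U \<and>
     (\<forall>i j. pos q' i - pos q' j = U *v (pos q i - pos q j))}"

lemma congruence_class_refl: "q \<in> congruence_class q"
  unfolding congruence_class_def by (auto intro!: exI[of _ "mat 1"] simp: orthogonal_matrix_id)

lemma norm_orthogonal_matrix_mult:
  fixes U :: "real ^ 'd ^ 'd"
  assumes "orthogonal_matrix U"
  shows "norm (U *v x) = norm x"
  using assms orthogonal_transformation_matrix[of "(*v) U"]
  by (simp add: orthogonal_transformation)

lemma congruence_class_translate: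
  assumes "q' \<in> congruence_class q"
  shows "config_of (\<lambda>i. pos q' i + b) \<in> congruence_class q"
  using assms by (simp add: congruence_class_def)

lemma congruence_class_rotate:
  assumes "q' \<in> congruence_class q" "orthogonal_matrix V"
  shows "config_of (\<lambda>i. V *v pos q' i) \<in> congruence_class q"
proof -
  obtain U where "orthogonal_matrix U"
    and "\<And>i j. pos q' i - pos q' j = U *v (pos q i - pos q j)"
    using assms(1) by (auto simp: congruence_class_def)
  then show ?thesis
    using assms(2) unfolding congruence_class_def
    by (auto intro!: exI[of _ "V ** U"] orthogonal_matrix_mul
        simp: matrix_vector_mul_assoc[symmetric] simp flip: matrix_vector_mult_diff_distrib)
qed

lemma edge_fun_congruence_class:
  assumes "q' \<in> congruence_class q"
  shows "edge_fun E i q' = edge_fun E i q"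
  using assms by (auto simp: congruence_class_def edge_fun_def norm_orthogonal_matrix_mult)

lemma congruence_class_imp_congruent:
  fixes p q :: "('d::finite, 'n::finite) config"
  assumes "p \<in> congruence_class q"
  shows "congruent_configs p q"
proof -
  obtain U where U: "orthogonal_matrix U"
    and eq: "\<And>i j. pos p i - pos p j = U *v (pos q i - pos q j)"
    using assms by (auto simp: congruence_class_def)
  \<comment> \<open>Any vertex may serve as the base point of the isometry.\<close>
  fix j :: 'n
  let ?T = "\<lambda>x. transpose U *v (x - pos p j) + pos q j"
  have "dist (?T x) (?T y) = dist x y" for x y
  proof -
    have "?T x - ?T y = transpose U *v (x - y)"
      by (simp del: transpose_matrix_vector flip: matrix_vector_mult_diff_distrib)
    then show ?thesis
      using U by (simp only: dist_norm norm_orthogonal_matrix_mult orthogonal_matrix_transpose)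
  qed
  moreover have "pos q i = ?T (pos p i)" for i
  proof -
    have "transpose U ** U = mat 1" using U by (simp add: orthogonal_matrix)
    then show ?thesis by (simp add: eq matrix_vector_mul_assoc)
  qed
  ultimately show ?thesis unfolding congruent_configs_def by (intro exI[of _ ?T]) blast
qed

text \<open>
  The class is the projection of a closed set along the compact factor of orthogonal matrices.
\<close>

lemma closed_congruence_class: "closed (congruence_class (q :: ('d::finite, 'n::finite) config))"
proof -
  let ?T = "{z :: (real ^ 'd ^ 'd) \<times> ('d, 'n) config.
    \<forall>i j. pos (snd z) i - pos (snd z) j = fst z *v (pos q i - pos q j)}"
  have "closed ?T"
    unfolding matrix_vector_mult_def
    by (intro closed_Collect_all closed_Collect_eq continuous_intros)
  from closed_compact_projection[OF compact_orthogonal_matrices this]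
  show ?thesis by (simp add: congruence_class_def)
qed

section \<open>The closest congruent configuration\<close>

text \<open>
  This is the rotation in the plane of axes \<open>a\<close> and \<open>b\<close> with cosine \<open>c\<close> and sine \<open>s\<close>,
  written as the identity plus a correction so that its pairings with other vectors expand
  directly.
\<close>

lemma orthogonal_matrix_plane_rotation:
  fixes a b :: "'d::finite"
  assumes "a \<noteq> b" "c\<^sup>2 + s\<^sup>2 = (1::real)"
  obtains U :: "real ^ 'd ^ 'd" where "orthogonal_matrix U"
    and "\<And>x. U *v x = x + ((c - 1) * x $ a + s * x $ b) *\<^sub>R axis a 1
                          + ((c - 1) * x $ b - s * x $ a) *\<^sub>R axis b 1"
proof -
  define f :: "real ^ 'd \<Rightarrow> real ^ 'd" where
    "f x = x + ((c - 1) * x $ a + s * x $ b) *\<^sub>R axis a 1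
             + ((c - 1) * x $ b - s * x $ a) *\<^sub>R axis b 1" for x
  have lin: "linear f"
    by (rule linearI) (auto simp: f_def algebra_simps)
  have "f x \<bullet> f x = x \<bullet> x" for x
  proof -
    define \<alpha> \<beta> where "\<alpha> = (c - 1) * x $ a + s * x $ b" and "\<beta> = (c - 1) * x $ b - s * x $ a"
    have "f x = x + \<alpha> *\<^sub>R axis a 1 + \<beta> *\<^sub>R axis b 1"
      by (simp add: f_def \<alpha>_def \<beta>_def)
    moreover have "axis a (1::real) $ b = 0" "axis b (1::real) $ a = 0"
      using assms(1) by (simp_all add: axis_def)
    ultimately have "f x \<bullet> f x = x \<bullet> x + (2 * (\<alpha> * x $ a + \<beta> * x $ b) + \<alpha>\<^sup>2 + \<beta>\<^sup>2)"
      by (simp add: inner_add_left inner_add_right inner_axis inner_axis'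
          power2_eq_square algebra_simps)
    also have "2 * (\<alpha> * x $ a + \<beta> * x $ b) + \<alpha>\<^sup>2 + \<beta>\<^sup>2 =
        (c\<^sup>2 + s\<^sup>2 - 1) * ((x $ a)\<^sup>2 + (x $ b)\<^sup>2)"
      by (simp add: \<alpha>_def \<beta>_def power2_eq_square algebra_simps)
    finally show ?thesis using assms(2) by simp
  qed
  then have "orthogonal_transformation f"
    using lin by (simp add: orthogonal_transformation norm_eq)
  then have "orthogonal_matrix (matrix f)"
    by (simp add: orthogonal_transformation_matrix)
  moreover have "matrix f *v x = f x" for x
    using lin by (simp add: matrix_works)
  ultimately show ?thesis using that f_def by simp
qed

text \<open>
  Skew-symmetric matrices are the tangent directions of the orthogonal group at the identity,
  so this is a first-order optimality condition. Rather than differentiating along a curve of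
  rotations, the proof compares with plane rotations. The objective is \<open>\<Sum>a b. U\<^sub>a\<^sub>b M\<^sub>a\<^sub>b\<close>;
  optimality within each coordinate plane makes the moment matrix \<open>M\<close> symmetric, and a
  symmetric matrix pairs to zero with a skew one.
\<close>

lemma rotation_maximal_imp_skew_stationary:
  fixes x y :: "'n::finite \<Rightarrow> real ^ 'd" and A :: "real ^ 'd ^ 'd"
  assumes max: "\<And>U. orthogonal_matrix U \<Longrightarrow>
      (\<Sum>i\<in>UNIV. (U *v x i) \<bullet> y i) \<le> (\<Sum>i\<in>UNIV. x i \<bullet> y i)"
    and A: "transpose A = - A"
  shows "(\<Sum>i\<in>UNIV. (A *v x i) \<bullet> y i) = 0"
proof -
  define M where "M a b = (\<Sum>i\<in>UNIV. y i $ a * x i $ b)" for a b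
  have sym: "M a b = M b a" for a b
  proof (cases "a = b")
    case False
    define \<alpha> \<beta> where "\<alpha> = M a a + M b b" and "\<beta> = M a b - M b a"
    have ineq: "(c - 1) * \<alpha> + s * \<beta> \<le> 0" if cs: "c\<^sup>2 + s\<^sup>2 = 1" for c s
    proof -
      obtain U where U: "orthogonal_matrix U"
        and rot: "\<And>z. U *v z = z + ((c - 1) * z $ a + s * z $ b) *\<^sub>R axis a 1
                          + ((c - 1) * z $ b - s * z $ a) *\<^sub>R axis b 1"
        using orthogonal_matrix_plane_rotation[OF False cs] by blast
      have "(\<Sum>i\<in>UNIV. (U *v x i) \<bullet> y i) =
        (\<Sum>i\<in>UNIV. x i \<bullet> y i) + ((c - 1) * \<alpha> + s * \<beta>)"
        by (simp add: rot inner_add_left inner_axis' \<alpha>_def \<beta>_def M_def sum_distrib_left sum_subtractf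
            sum.distrib algebra_simps)
      with max[OF U] show ?thesis by simp
    qed
    have "\<beta> = 0"
    proof (rule ccontr)
      assume "\<beta> \<noteq> 0"
      \<comment> \<open>The rotation whose cosine and sine are proportional to \<open>\<alpha>\<close> and \<open>\<beta>\<close> changes the objective
        by \<open>\<rho> - \<alpha>\<close>, which is positive unless \<open>\<beta> = 0\<close>.\<close>
      define \<rho> where "\<rho> = sqrt (\<alpha>\<^sup>2 + \<beta>\<^sup>2)"
      have pos: "\<alpha>\<^sup>2 + \<beta>\<^sup>2 > 0" using \<open>\<beta> \<noteq> 0\<close> by (simp add: sum_power2_gt_zero_iff)
      then have \<rho>: "\<rho> > 0" and \<rho>2: "\<rho>\<^sup>2 = \<alpha>\<^sup>2 + \<beta>\<^sup>2" by (simp_all add: \<rho>_def)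
      have "(\<alpha> / \<rho>)\<^sup>2 + (\<beta> / \<rho>)\<^sup>2 = 1"
        using \<rho> by (simp add: power_divide flip: add_divide_distrib \<rho>2)
      from ineq[OF this] have "(\<alpha>\<^sup>2 + \<beta>\<^sup>2) / \<rho> \<le> \<alpha>"
        by (simp add: power2_eq_square algebra_simps add_divide_distrib)
      then have "\<rho> \<le> \<alpha>" unfolding \<rho>2[symmetric] using \<rho> by (simp add: power2_eq_square)
      then have "\<rho>\<^sup>2 \<le> \<alpha>\<^sup>2" using \<rho> by (intro power_mono) auto
      with \<rho>2 \<open>\<beta> \<noteq> 0\<close> show False by simp
    qed
    then show ?thesis by (simp add: \<beta>_def)
  qed simp
  have skew: "A $ a $ b = - A $ b $ a" for a b
    using arg_cong[OF A, of "\<lambda>B. B $ b $ a"] by (simp add: transpose_def)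
  have "(\<Sum>i\<in>UNIV. (A *v x i) \<bullet> y i) = (\<Sum>a\<in>UNIV. \<Sum>b\<in>UNIV. A $ a $ b * M a b)"
    (is "?L = ?R")
  proof -
    have "?L = (\<Sum>i\<in>UNIV. \<Sum>a\<in>UNIV. \<Sum>b\<in>UNIV. A $ a $ b * (y i $ a * x i $ b))"
      by (simp add: inner_vec_def matrix_vector_mult_def sum_distrib_left sum_distrib_right mult_ac)
    also have "\<dots> = (\<Sum>a\<in>UNIV. \<Sum>i\<in>UNIV. \<Sum>b\<in>UNIV. A $ a $ b * (y i $ a * x i $ b))"
      by (rule sum.swap)
    also have "\<dots> = (\<Sum>a\<in>UNIV. \<Sum>b\<in>UNIV. \<Sum>i\<in>UNIV. A $ a $ b * (y i $ a * x i $ b))"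
      by (intro sum.cong refl, rule sum.swap)
    finally show ?thesis by (simp add: M_def sum_distrib_left)
  qed
  moreover have "?R = - ?R"
  proof -
    have "?R = (\<Sum>b\<in>UNIV. \<Sum>a\<in>UNIV. A $ a $ b * M a b)"
      by (rule sum.swap)
    also have "\<dots> = (\<Sum>b\<in>UNIV. \<Sum>a\<in>UNIV. - (A $ b $ a * M b a))"
      by (intro sum.cong refl) (subst skew, subst sym, simp)
    finally show ?thesis by (simp add: sum_negf)
  qed
  ultimately show ?thesis by simp
qed

text \<open>
  First-order optimality of the distance over the congruence class: comparison with translates
  of \<open>q'\<close> makes the displacements sum to zero, and comparison with its rotations handles the
  infinitesimal rotations. The rotational condition refers to rotating \<open>q'\<close>, while trivial flexes
  rotate \<open>p\<close>; for skew \<open>A\<close> the two agree, because \<open>A y\<close> is orthogonal to \<open>y\<close>.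
\<close>

lemma closest_congruent_orthogonal:
  fixes p q' :: "('d::finite, 'n::finite) config"
  assumes q': "q' \<in> congruence_class q"
    and closest: "\<And>r. r \<in> congruence_class q \<Longrightarrow> dist p q' \<le> dist p r"
  shows "q' - p \<in> orthogonal_comp (trivial_flexes p)"
proof -
  let ?v = "\<lambda>i. pos q' i - pos p i"
  have dist_sq: "(dist p r)\<^sup>2 = (\<Sum>i\<in>UNIV. (pos r i - pos p i) \<bullet> (pos r i - pos p i))"
    for r :: "('d, 'n) config"
    by (simp add: dist_norm norm_minus_commute[of p] power2_norm_eq_inner inner_config pos_diff)
  have min: "(\<Sum>i\<in>UNIV. ?v i \<bullet> ?v i) \<le> (\<Sum>i\<in>UNIV. (pos r i - pos p i) \<bullet> (pos r i - pos p i))"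
    if "r \<in> congruence_class q" for r
    using closest[OF that] by (simp flip: dist_sq)
  have sum0: "(\<Sum>i\<in>UNIV. ?v i) = 0"
  proof -
    define n where "n = real CARD('n)"
    have n: "n > 0" by (simp add: n_def)
    define s where "s = (\<Sum>i\<in>UNIV. ?v i)"
    \<comment> \<open>This translation brings the centroids together.\<close>
    define b where "b = - (1 / n) *\<^sub>R s"
    have "(\<Sum>i\<in>UNIV. ?v i \<bullet> ?v i) \<le> (\<Sum>i\<in>UNIV. (?v i + b) \<bullet> (?v i + b))"
      using min[OF congruence_class_translate[OF q', of b]] by (simp add: algebra_simps)
    also have "\<dots> = (\<Sum>i\<in>UNIV. ?v i \<bullet> ?v i) + (\<Sum>i\<in>UNIV. 2 * (?v i \<bullet> b)) + (\<Sum>i\<in>(UNIV::'n set). b \<bullet> b)"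
      unfolding sum.distrib[symmetric]
      by (intro sum.cong) (auto simp: inner_add_left inner_add_right inner_commute)
    also have "(\<Sum>i\<in>UNIV. 2 * (?v i \<bullet> b)) = 2 * (s \<bullet> b)"
      by (simp add: s_def inner_sum_left sum_distrib_left)
    also have "(\<Sum>i\<in>(UNIV::'n set). b \<bullet> b) = n * (b \<bullet> b)"
      by (simp add: n_def)
    finally have "0 \<le> 2 * (s \<bullet> b) + n * (b \<bullet> b)" by simp
    also have "\<dots> = - (s \<bullet> s) / n"
      using n by (simp add: b_def field_simps)
    finally have "s \<bullet> s \<le> 0" using n by (simp add: field_simps)
    then show ?thesis
      using inner_ge_zero[of s] by (simp add: s_def[symmetric])
  qed
  have max: "(\<Sum>i\<in>UNIV. (U *v pos q' i) \<bullet> pos p i) \<le> (\<Sum>i\<in>UNIV. pos q' i \<bullet> pos p i)"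
    if U: "orthogonal_matrix U" for U
  proof -
    have exp: "(x - y) \<bullet> (x - y) = x \<bullet> x - 2 * (x \<bullet> y) + y \<bullet> y" for x y :: "real ^ 'd"
      by (simp add: inner_diff_left inner_diff_right inner_commute)
    have "(U *v x) \<bullet> (U *v x) = x \<bullet> x" for x
      using norm_orthogonal_matrix_mult[OF U, of x] by (simp add: norm_eq)
    then show ?thesis
      using min[OF congruence_class_rotate[OF q' U]]
      by (simp add: exp sum.distrib sum_subtractf flip: sum_distrib_left)
  qed
  have "w \<bullet> (q' - p) = 0" if trivial: "w \<in> trivial_flexes p" for w
  proof -
    obtain A :: "real ^ 'd ^ 'd" and b where A: "transpose A = - A"
      and w: "\<And>i. pos w i = A *v pos p i + b"
      using trivial by (auto simp: trivial_flexes_def)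
    have "(A *v x) \<bullet> y = - ((A *v y) \<bullet> x)" for x y
    proof -
      have "(A *v x) \<bullet> y = x \<bullet> (transpose A *v y)"
        by (metis dot_lmul_matrix inner_commute transpose_matrix_vector)
      also have "\<dots> = - ((A *v y) \<bullet> x)"
        by (simp add: A inner_commute matrix_vector_mult_def inner_vec_def sum_negf)
      finally show ?thesis .
    qed
    note adj = this
    have self0: "(A *v x) \<bullet> x = 0" for x using adj[of x x] by simp
    have L0: "(\<Sum>i\<in>UNIV. (A *v pos q' i) \<bullet> pos p i) = 0"
      using max A by (rule rotation_maximal_imp_skew_stationary)
    have "w \<bullet> (q' - p) = (\<Sum>i\<in>UNIV. - ((A *v pos q' i) \<bullet> pos p i) + b \<bullet> ?v i)"
      unfolding inner_config pos_diff
    proof (intro sum.cong refl)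
      fix i
      show "pos w i \<bullet> ?v i = - ((A *v pos q' i) \<bullet> pos p i) + b \<bullet> ?v i"
        using adj[of "pos p i" "pos q' i"] self0[of "pos p i"]
        by (simp add: w inner_add_left inner_diff_right)
    qed
    also have "\<dots> = b \<bullet> (\<Sum>i\<in>UNIV. ?v i)"
      unfolding sum.distrib inner_sum_right sum_negf L0 by simp
    finally show ?thesis by (simp only: sum0 inner_zero_right)
  qed
  then show ?thesis
    by (auto simp: orthogonal_comp_def orthogonal_def inner_commute)
qed

lemma exists_congruent_orthogonal:
  fixes p q :: "('d::finite, 'n::finite) config"
  obtains q' where "q' \<in> congruence_class q" "dist p q' \<le> dist p q"
    "q' - p \<in> orthogonal_comp (trivial_flexes p)"
proof -
  obtain q' where q': "q' \<in> congruence_class q"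
    and "\<And>r. r \<in> congruence_class q \<Longrightarrow> dist p q' \<le> dist p r"
    using distance_attains_inf[OF closed_congruence_class[of q], of p]
      congruence_class_refl[of q] by blast
  with closest_congruent_orthogonal[OF q'] congruence_class_refl[of q] that
  show ?thesis by blast
qed

section \<open>Positivity of the stress energy\<close>

text \<open>
  If \<open>S v \<le> 0\<close>, then the normalised \<open>v\<close> lies in a compact set that contains no first-order
  flex, so the rows other than \<open>k\<close> give at least \<open>c * norm v\<close> in total. Feasibility bounds
  the same total by \<open>C * (norm v)\<^sup>2\<close>, whence \<open>norm v \<ge> c / C\<close>.
\<close>

lemma stress_energy_pos_near:
  fixes p :: "('d::finite, 'n::finite) config" and E :: "'m::finite \<Rightarrow> 'n \<times> 'n"
  assumes \<omega>: "guarantees_prestress_stability E p \<omega>" and k: "\<omega> $ k \<noteq> 0"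
  obtains \<delta> where "\<delta> > 0"
    "\<And>v. \<lbrakk>v \<in> orthogonal_comp (trivial_flexes p); v \<noteq> 0; norm v < \<delta>;
          \<And>i. i \<noteq> k \<Longrightarrow> edge_fun E i (p + v) = edge_fun E i p\<rbrakk> \<Longrightarrow> stress_energy E \<omega> v > 0"
proof -
  let ?R = "\<lambda>v i. (rigidity_matrix E p *v v) $ i"
  have stress: "self_stress E p \<omega>"
    and pos: "\<And>v. \<lbrakk>rigidity_matrix E p *v v = 0; v \<in> orthogonal_comp (trivial_flexes p); v \<noteq> 0\<rbrakk>
                \<Longrightarrow> stress_energy E \<omega> v > 0"
    using \<omega> by (auto simp: guarantees_prestress_stability_def null_space_def
        inner_rigidity_matrix_self)
  define g where "g v = (\<Sum>i\<in>UNIV - {k}. \<bar>?R v i\<bar>)" for v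
  \<comment> \<open>Equilibrium with \<open>\<omega>\<^sub>k \<noteq> 0\<close> makes row \<open>k\<close> a combination of the other rows.\<close>
  have g0: "rigidity_matrix E p *v v = 0" if "g v = 0" for v
  proof -
    have other: "?R v i = 0" if "i \<noteq> k" for i
      using \<open>g v = 0\<close> that by (simp add: g_def sum_nonneg_eq_0_iff)
    have "0 = (\<Sum>i\<in>UNIV. \<omega> $ i * ?R v i)"
      using self_stress_inner[OF stress] by simp
    also have "\<dots> = \<omega> $ k * ?R v k + (\<Sum>i\<in>UNIV - {k}. \<omega> $ i * ?R v i)"
      by (simp add: sum.remove[of _ k])
    also have "\<dots> = \<omega> $ k * ?R v k"
      using other by simp
    finally have "?R v k = 0" using k by simp
    with other show ?thesis unfolding vec_eq_iff by (metis zero_index)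
  qed
  have g_nonneg: "g v \<ge> 0" for v by (simp add: g_def sum_nonneg)
  have g_scale: "g (t *\<^sub>R v) = \<bar>t\<bar> * g v" for t v
    by (simp add: g_def matrix_vector_mult_scaleR abs_mult sum_distrib_left)
  define K where "K = orthogonal_comp (trivial_flexes p) \<inter> sphere 0 1 \<inter> {v. stress_energy E \<omega> v \<le> 0}"
  have contS: "continuous_on UNIV (stress_energy E \<omega> :: ('d, 'n) config \<Rightarrow> real)"
    unfolding stress_energy_def edge_fun_def by (intro continuous_intros)
  have contg: "continuous_on K g"
    unfolding g_def matrix_vector_mult_def by (intro continuous_intros)
  have "closed (orthogonal_comp (trivial_flexes p))"
    by (intro closed_subspace subspace_orthogonal_comp)
  moreover have "closed {v :: ('d, 'n) config. stress_energy E \<omega> v \<le> 0}"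
    by (intro closed_Collect_le contS continuous_intros)
  ultimately have "compact K"
    unfolding K_def by (metis closed_Int_compact compact_Int_closed compact_sphere)
  have "\<exists>c>0. \<forall>u\<in>K. c \<le> g u"
  proof (cases "K = {}")
    case False
    obtain u where u: "u \<in> K" "\<forall>w\<in>K. g u \<le> g w"
      using continuous_attains_inf[OF \<open>compact K\<close> False contg] by blast
    have "g u \<noteq> 0"
      using g0[of u] pos[of u] u(1) unfolding K_def by force
    with u(2) g_nonneg[of u] show ?thesis by (intro exI[of _ "g u"]) auto
  qed (auto intro: exI[of _ 1])
  then obtain c where c: "c > 0" "\<And>u. u \<in> K \<Longrightarrow> c \<le> g u" by blast
  define C where "C = 4 * real CARD('m)"
  have C: "C > 0" by (simp add: C_def)
  show ?thesis
  proof (rule that[of "c / C"])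
    show "c / C > 0" using c C by simp
  next
    fix v :: "('d, 'n) config"
    assume v: "v \<in> orthogonal_comp (trivial_flexes p)" "v \<noteq> 0" "norm v < c / C"
      and feas: "\<And>i. i \<noteq> k \<Longrightarrow> edge_fun E i (p + v) = edge_fun E i p"
    show "stress_energy E \<omega> v > 0"
    proof (rule ccontr)
      assume neg: "\<not> stress_energy E \<omega> v > 0"
      have nv: "norm v > 0" using v(2) by simp
      define u where "u = (1 / norm v) *\<^sub>R v"
      have "u \<in> orthogonal_comp (trivial_flexes p)"
        unfolding u_def by (intro subspace_scale subspace_orthogonal_comp v(1))
      moreover have "stress_energy E \<omega> u \<le> 0"
        using neg unfolding u_def stress_energy_scaleR by (intro mult_nonneg_nonpos) auto
      ultimately have "u \<in> K"
        using nv by (simp add: K_def u_def)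
      then have "c \<le> g v / norm v"
        using c(2)[of u] by (simp add: u_def g_scale)
      then have "c * norm v \<le> g v" using nv by (simp add: field_simps)
      also have "g v = (\<Sum>i\<in>UNIV - {k}. edge_fun E i v)"
        unfolding g_def
      proof (intro sum.cong refl)
        fix i assume "i \<in> UNIV - {k}"
        then have "?R v i = - edge_fun E i v"
          using feas[of i] by (simp add: edge_fun_add)
        then show "\<bar>?R v i\<bar> = edge_fun E i v"
          using edge_fun_nonneg[of E i v] by simp
      qed
      also have "\<dots> \<le> (\<Sum>i\<in>UNIV. edge_fun E i v)"
        by (intro sum_mono2) (auto simp: edge_fun_nonneg)
      also have "\<dots> \<le> (\<Sum>i\<in>(UNIV::'m set). 4 * (norm v)\<^sup>2)"
        by (intro sum_mono edge_fun_le)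
      also have "\<dots> = C * norm v * norm v"
        by (simp add: C_def power2_eq_square)
      finally have "c \<le> C * norm v" using nv by simp
      with v(3) C show False by (simp add: field_simps)
    qed
  qed
qed

text \<open>
  When every edge other than \<open>k\<close> keeps its length, the stress energy of the displacement is
  carried by edge \<open>k\<close> alone. Keeping the factor \<open>\<omega> $ k\<close> treats the minimum and the maximum
  problem at once.
\<close>

lemma stressed_edge_strict_local:
  fixes p :: "('d::finite, 'n::finite) config" and E :: "'m::finite \<Rightarrow> 'n \<times> 'n"
  assumes \<omega>: "guarantees_prestress_stability E p \<omega>" and k: "\<omega> $ k \<noteq> 0"
  shows "\<exists>U. open U \<and> p \<in> U \<and>
    (\<forall>q\<in>U. feasible E k (edge_length E p) q \<and> \<not> congruent_configs p q \<longrightarrow>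
      \<omega> $ k * (edge_fun E k q - edge_fun E k p) > 0)"
proof -
  obtain \<delta> where \<delta>: "\<delta> > 0"
    and energy: "\<And>v. \<lbrakk>v \<in> orthogonal_comp (trivial_flexes p); v \<noteq> 0; norm v < \<delta>;
          \<And>i. i \<noteq> k \<Longrightarrow> edge_fun E i (p + v) = edge_fun E i p\<rbrakk> \<Longrightarrow> stress_energy E \<omega> v > 0"
    using stress_energy_pos_near[OF assms] by blast
  show ?thesis
  proof (intro exI[of _ "ball p \<delta>"] conjI ballI impI; (elim conjE)?)
    fix q assume q: "q \<in> ball p \<delta>" and feas: "feasible E k (edge_length E p) q"
      and ncong: "\<not> congruent_configs p q"
    obtain q' where q': "q' \<in> congruence_class q" "dist p q' \<le> dist p q"
      "q' - p \<in> orthogonal_comp (trivial_flexes p)"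
      by (rule exists_congruent_orthogonal)
    have same: "edge_fun E i q' = edge_fun E i q" for i
      using edge_fun_congruence_class[OF q'(1)] .
    have other: "edge_fun E i q = edge_fun E i p" if "i \<noteq> k" for i
      using feas that by (simp add: feasible_def edge_length_def edge_fun_def)
    have "q' \<noteq> p"
      using ncong congruence_class_imp_congruent q'(1) by blast
    then have "0 < stress_energy E \<omega> (q' - p)"
      using q q' by (intro energy) (auto simp: same other dist_norm norm_minus_commute)
    also have "\<dots> = (\<Sum>i\<in>UNIV. \<omega> $ i * (edge_fun E i q - edge_fun E i p))"
      using self_stress_energy_diff[of E p \<omega> "q' - p"] \<omega>
      by (simp add: guarantees_prestress_stability_def same)
    also have "\<dots> = \<omega> $ k * (edge_fun E k q - edge_fun E k p)"
      by (simp add: sum.remove[of _ k] other)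
    finally show "\<omega> $ k * (edge_fun E k q - edge_fun E k p) > 0" .
  qed (use \<delta> in auto)
qed

theorem theorem3p6:
  fixes E :: "'m::finite \<Rightarrow> 'n::finite \<times> 'n"
    and pstar :: "('d::finite, 'n) config"
    and \<omega> :: "real ^ 'm"
  assumes "bar_edges E"
    and "prestress_stable E pstar"
    and "guarantees_prestress_stability E pstar \<omega>"
  shows "\<forall>k. (\<omega> $ k > 0 \<longrightarrow> strict_local_solution_plus E k (edge_length E pstar) pstar) \<and>
             (\<omega> $ k < 0 \<longrightarrow> strict_local_solution_minus E k (edge_length E pstar) pstar)"
proof (intro allI conjI impI)
  fix k
  have feas: "feasible E k (edge_length E pstar) pstar"
    by (simp add: feasible_def edge_length_def edge_fun_def)
  have near: "\<exists>U. open U \<and> pstar \<in> U \<and>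
    (\<forall>q\<in>U. feasible E k (edge_length E pstar) q \<and> \<not> congruent_configs pstar q \<longrightarrow>
      \<omega> $ k * (edge_fun E k q - edge_fun E k pstar) > 0)" if "\<omega> $ k \<noteq> 0"
    using assms(3) that by (rule stressed_edge_strict_local)
  show "strict_local_solution_plus E k (edge_length E pstar) pstar" if "\<omega> $ k > 0"
    unfolding strict_local_solution_plus_def
    using near feas that by (simp add: zero_less_mult_iff)
  show "strict_local_solution_minus E k (edge_length E pstar) pstar" if "\<omega> $ k < 0"
    unfolding strict_local_solution_minus_def
    using near feas that by (simp add: zero_less_mult_iff)
qed

end
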